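(* Let $(A,\triangleright,\triangleleft)$ be an L-dendriform algebra with a nondegenerate (skew-symmetric) 2-cocycle $\mathcal B$. Then there exists an L-quadri-algebra structure $(A,\searrow,\nearrow,\nwarrow,\swarrow)$ on $A$ defined, for all $x,y,z\in A$, by $$\mathcal B(x\searrow y,z)=-\mathcal B(y,[x,z]),\quad \mathcal B(x\nwarrow y,z)=\mathcal B(y,z\triangleright x),$$ $$\mathcal B(x\nearrow y,z)=-\mathcal B(y,z\circ x),\quad \mathcal B(x\swarrow y,z)=-\mathcal B(y,z\bullet x),$$ such that $(A,\triangleright,\triangleleft)$ is the associated horizontal L-dendriform algebra.
   Context: All algebras are finite-dimensional over a field of characteristic zero. An L-dendriform algebra $(A,\triangleright,\triangleleft)$ is a vector space $A$ with two bilinear products such that for all $x,y,z\in A$: $x\triangleright(y\triangleright z)-(x\bullet y)\triangleright z=y\triangleright(x\triangleright z)-(y\bullet x)\triangleright z$ and $x\triangleright(y\triangleleft z)-(x\triangleright y)\triangleleft z=y\triangleleft(x\bullet z)-(y\triangleleft x)\triangleleft z$, where $x\bullet y=x\triangleright y+x\triangleleft y$. Put also $x\circ y=x\triangleright y-y\triangleleft x$ and $[x,y]=x\bullet y-y\bullet x$. A 2-cocycle of $(A,\triangleright,\triangleleft)$ is a skew-symmetric bilinear form $\mathcal B$ on $A$ with $\mathcal B(x\triangleleft y,z)=-\mathcal B(y,z\circ x)+\mathcal B(x,z\bullet y)$ for all $x,y,z\in A$. An L-quadri-algebra $(A,\searrow,\nearrow,\nwarrow,\swarrow)$ is a vector space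 with four bilinear products such that for all $x,y,z\in A$: $x\searrow(y\searrow z)-(x\ast y)\searrow z=y\searrow(x\searrow z)-(y\ast x)\searrow z$; $x\searrow(y\nearrow z)-(x\vee y)\nearrow z=y\nearrow(x\succ z)-(y\wedge x)\nearrow z$; $x\searrow(y\nwarrow z)-(x\searrow y)\nwarrow z=y\nwarrow(x\ast z)-(y\nwarrow x)\nwarrow z$; $x\nearrow(y\prec z)-(x\nearrow y)\nwarrow z=y\swarrow(x\wedge z)-(y\swarrow x)\nwarrow z$; $x\searrow(y\swarrow z)-(x\succ y)\swarrow z=y\swarrow(x\vee z)-(y\prec x)\swarrow z$; where $x\succ y=x\searrow y+x\nearrow y$, $x\prec y=x\nwarrow y+x\swarrow y$, $x\vee y=x\searrow y+x\swarrow y$, $x\wedge y=x\nearrow y+x\nwarrow y$, $x\ast y=x\searrow y+x\nearrow y+x\nwarrow y+x\swarrow y$. Its associated horizontal L-dendriform algebra has products $x\triangleright y=x\searrow y-y\nwarrow x$, $x\triangleleft y=x\nearrow y-y\swarrow x$. *)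

theory Defs
  imports Main "HOL.Vector_Spaces"
begin

text \<open>The vector space is a whole type \<open>'a\<close>, with an explicit scalar multiplication by a
  field of characteristic zero.\<close>

locale fin_dim_space = vector_space scale
  for scale :: "'k::field_char_0 \<Rightarrow> 'a::ab_group_add \<Rightarrow> 'a" +
  assumes finite_dimensional: "\<exists>Basis. finite_dimensional_vector_space scale Basis"

definition bilinear_product ::
  "('k::field \<Rightarrow> 'a::ab_group_add \<Rightarrow> 'a) \<Rightarrow> ('a \<Rightarrow> 'a \<Rightarrow> 'a) \<Rightarrow> bool" where
  "bilinear_product scale p \<longleftrightarrow>
     (\<forall>x. Vector_Spaces.linear scale scale (\<lambda>y. p x y)) \<and>
     (\<forall>y. Vector_Spaces.linear scale scale (\<lambda>x. p x y))"

definition bilinear_form ::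
  "('k::field \<Rightarrow> 'a::ab_group_add \<Rightarrow> 'a) \<Rightarrow> ('a \<Rightarrow> 'a \<Rightarrow> 'k) \<Rightarrow> bool" where
  "bilinear_form scale B \<longleftrightarrow>
     (\<forall>x. Vector_Spaces.linear scale (*) (\<lambda>y. B x y)) \<and>
     (\<forall>y. Vector_Spaces.linear scale (*) (\<lambda>x. B x y))"

definition skew_symmetric :: "('a \<Rightarrow> 'a \<Rightarrow> 'k::field) \<Rightarrow> bool" where
  "skew_symmetric B \<longleftrightarrow> (\<forall>x y. B x y = - B y x)"

definition nondegenerate :: "('a::zero \<Rightarrow> 'a \<Rightarrow> 'k::field) \<Rightarrow> bool" where
  "nondegenerate B \<longleftrightarrow>
     (\<forall>x. (\<forall>y. B x y = 0) \<longrightarrow> x = 0) \<and> (\<forall>y. (\<forall>x. B x y = 0) \<longrightarrow> y = 0)"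

locale dendriform_products =
  fixes rt :: "'a::ab_group_add \<Rightarrow> 'a \<Rightarrow> 'a" (infixl "\<triangleright>" 70)
    and lt :: "'a \<Rightarrow> 'a \<Rightarrow> 'a" (infixl "\<triangleleft>" 70)
begin

definition bullet :: "'a \<Rightarrow> 'a \<Rightarrow> 'a" (infixl "\<bullet>" 70) where
  "x \<bullet> y = x \<triangleright> y + x \<triangleleft> y"

definition circ :: "'a \<Rightarrow> 'a \<Rightarrow> 'a" (infixl "\<odot>" 70) where
  "x \<odot> y = x \<triangleright> y - y \<triangleleft> x"

definition bracket :: "'a \<Rightarrow> 'a \<Rightarrow> 'a" where
  "bracket x y = x \<bullet> y - y \<bullet> x"

end

locale L_dendriform_algebra = fin_dim_space scale + dendriform_products rt lt
  for scale :: "'k::field_char_0 \<Rightarrow> 'a::ab_group_add \<Rightarrow> 'a"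
    and rt :: "'a \<Rightarrow> 'a \<Rightarrow> 'a" (infixl "\<triangleright>" 70)
    and lt :: "'a \<Rightarrow> 'a \<Rightarrow> 'a" (infixl "\<triangleleft>" 70) +
  assumes bilinear_rt: "bilinear_product scale (\<triangleright>)"
    and bilinear_lt: "bilinear_product scale (\<triangleleft>)"
    and dendriform1:
      "x \<triangleright> (y \<triangleright> z) - (x \<bullet> y) \<triangleright> z = y \<triangleright> (x \<triangleright> z) - (y \<bullet> x) \<triangleright> z"
    and dendriform2:
      "x \<triangleright> (y \<triangleleft> z) - (x \<triangleright> y) \<triangleleft> z = y \<triangleleft> (x \<bullet> z) - (y \<triangleleft> x) \<triangleleft> z"

definition two_cocycle ::
  "('k::field \<Rightarrow> 'a::ab_group_add \<Rightarrow> 'a) \<Rightarrow> ('a \<Rightarrow> 'a \<Rightarrow> 'a) \<Rightarrow> ('a \<Rightarrow> 'a \<Rightarrow> 'a) \<Rightarrow>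
   ('a \<Rightarrow> 'a \<Rightarrow> 'k) \<Rightarrow> bool" where
  "two_cocycle scale rt lt B \<longleftrightarrow>
     bilinear_form scale B \<and> skew_symmetric B \<and>
     (\<forall>x y z. B (lt x y) z =
        - B y (dendriform_products.circ rt lt z x) + B x (dendriform_products.bullet rt lt z y))"

locale quadri_products =
  fixes se :: "'a::ab_group_add \<Rightarrow> 'a \<Rightarrow> 'a" (infixl "\<searrow>" 70)
    and ne :: "'a \<Rightarrow> 'a \<Rightarrow> 'a" (infixl "\<nearrow>" 70)
    and nw :: "'a \<Rightarrow> 'a \<Rightarrow> 'a" (infixl "\<nwarrow>" 70)
    and sw :: "'a \<Rightarrow> 'a \<Rightarrow> 'a" (infixl "\<swarrow>" 70)
begin

definition succ :: "'a \<Rightarrow> 'a \<Rightarrow> 'a" (infixl "\<succ>" 70) where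
  "x \<succ> y = x \<searrow> y + x \<nearrow> y"

definition prec :: "'a \<Rightarrow> 'a \<Rightarrow> 'a" (infixl "\<prec>" 70) where
  "x \<prec> y = x \<nwarrow> y + x \<swarrow> y"

definition vee :: "'a \<Rightarrow> 'a \<Rightarrow> 'a" (infixl "\<squnion>" 70) where
  "x \<squnion> y = x \<searrow> y + x \<swarrow> y"

definition wedge :: "'a \<Rightarrow> 'a \<Rightarrow> 'a" (infixl "\<sqinter>" 70) where
  "x \<sqinter> y = x \<nearrow> y + x \<nwarrow> y"

definition star :: "'a \<Rightarrow> 'a \<Rightarrow> 'a" (infixl "\<star>" 70) where
  "x \<star> y = x \<searrow> y + x \<nearrow> y + x \<nwarrow> y + x \<swarrow> y"

text \<open>The pair \<open>(\<triangleright>, \<triangleleft>)\<close> of products of the associated horizontal L-dendriform algebra.\<close>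

definition horizontal :: "('a \<Rightarrow> 'a \<Rightarrow> 'a) \<times> ('a \<Rightarrow> 'a \<Rightarrow> 'a)" where
  "horizontal = (\<lambda>x y. x \<searrow> y - y \<nwarrow> x, \<lambda>x y. x \<nearrow> y - y \<swarrow> x)"

end

locale L_quadri_algebra = fin_dim_space scale + quadri_products se ne nw sw
  for scale :: "'k::field_char_0 \<Rightarrow> 'a::ab_group_add \<Rightarrow> 'a"
    and se :: "'a \<Rightarrow> 'a \<Rightarrow> 'a" (infixl "\<searrow>" 70)
    and ne :: "'a \<Rightarrow> 'a \<Rightarrow> 'a" (infixl "\<nearrow>" 70)
    and nw :: "'a \<Rightarrow> 'a \<Rightarrow> 'a" (infixl "\<nwarrow>" 70)
    and sw :: "'a \<Rightarrow> 'a \<Rightarrow> 'a" (infixl "\<swarrow>" 70) +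
  assumes bilinear_se: "bilinear_product scale (\<searrow>)"
    and bilinear_ne: "bilinear_product scale (\<nearrow>)"
    and bilinear_nw: "bilinear_product scale (\<nwarrow>)"
    and bilinear_sw: "bilinear_product scale (\<swarrow>)"
    and quadri1:
      "x \<searrow> (y \<searrow> z) - (x \<star> y) \<searrow> z = y \<searrow> (x \<searrow> z) - (y \<star> x) \<searrow> z"
    and quadri2:
      "x \<searrow> (y \<nearrow> z) - (x \<squnion> y) \<nearrow> z = y \<nearrow> (x \<succ> z) - (y \<sqinter> x) \<nearrow> z"
    and quadri3:
      "x \<searrow> (y \<nwarrow> z) - (x \<searrow> y) \<nwarrow> z = y \<nwarrow> (x \<star> z) - (y \<nwarrow> x) \<nwarrow> z"
    and quadri4:
      "x \<nearrow> (y \<prec> z) - (x \<nearrow> y) \<nwarrow> z = y \<swarrow> (x \<sqinter> z) - (y \<swarrow> x) \<nwarrow> z"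
    and quadri5:
      "x \<searrow> (y \<swarrow> z) - (x \<succ> y) \<swarrow> z = y \<swarrow> (x \<squnion> z) - (y \<prec> x) \<swarrow> z"

end

theory Submission
  imports Defs
begin

text \<open>
  Nondegeneracy in finite dimension makes every map \<open>z \<mapsto> B y (f z)\<close> representable, so the four
  products exist, and they are bilinear because \<open>B\<close> is left-cancellable. The cocycle identity, and
  the difference of two of its instances, says that \<open>\<nearrow>, \<swarrow>\<close> and \<open>\<searrow>, \<nwarrow>\<close> induce \<open>\<triangleleft>\<close> and \<open>\<triangleright>\<close>.
  In every L-quadri-algebra axiom the nested left factors combine into a horizontal product, e.g.
  \<open>(x \<nearrow> y) \<nwarrow> z - (y \<swarrow> x) \<nwarrow> z = (x \<triangleleft> y) \<nwarrow> z\<close>; hence pairing the axiom with \<open>w\<close> and moving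
  all operators to the second argument of \<open>B z\<close> leaves an identity between \<open>\<triangleright>\<close> and \<open>\<triangleleft>\<close> alone, which is
  a signed sum of L-dendriform axioms.
\<close>

section \<open>Nondegenerate forms and adjoint products in finite dimension\<close>

lemma bilinear_product_alt:
  assumes "vector_space scale"
  shows "bilinear_product scale p \<longleftrightarrow>
    (\<forall>x y z. p x (y + z) = p x y + p x z) \<and> (\<forall>x y z. p (x + y) z = p x z + p y z) \<and>
    (\<forall>c x y. p x (scale c y) = scale c (p x y)) \<and> (\<forall>c x y. p (scale c x) y = scale c (p x y))"
  using assms unfolding bilinear_product_def linear_iff by blast

lemma vector_space_field: "vector_space ((*) :: 'k::field \<Rightarrow> 'k \<Rightarrow> 'k)"
  by unfold_locales (simp_all add: algebra_simps)

lemma bilinear_form_alt: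
  assumes "vector_space scale"
  shows "bilinear_form scale B \<longleftrightarrow>
    (\<forall>x y z. B x (y + z) = B x y + B x z) \<and> (\<forall>x y z. B (x + y) z = B x z + B y z) \<and>
    (\<forall>c x y. B x (scale c y) = c * B x y) \<and> (\<forall>c x y. B (scale c x) y = c * B x y)"
  using assms vector_space_field unfolding bilinear_form_def linear_iff by blast

lemma nondegenerate_left_cancel:
  assumes "vector_space scale" "bilinear_form scale B" "nondegenerate B"
    and "\<And>z. B u z = B v z"
  shows "u = v"
proof -
  have "B (u - v) z + B v z = B u z" for z
    using assms(2) unfolding bilinear_form_alt[OF assms(1)] by (metis diff_add_cancel)
  then have "B (u - v) z = 0" for z
    using assms(4) by simp
  then show ?thesis
    using assms(3) unfolding nondegenerate_def by (metis eq_iff_diff_eq_0)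
qed

text \<open>Nondegeneracy makes \<open>u \<mapsto> B u\<close> injective into the dual space, hence
  surjective by dimension.\<close>

lemma (in finite_dimensional_vector_space) nondegenerate_represents:
  assumes form: "bilinear_form scale B" and nd: "nondegenerate B"
    and \<phi>: "Vector_Spaces.linear scale (*) \<phi>"
  shows "\<exists>u. \<forall>z. B u z = \<phi> z"
proof -
  interpret K: vector_space_pair scale "(*)"
    by (simp add: vector_space_pair_def vector_space_axioms vector_space_field)
  have linB: "Vector_Spaces.linear scale (*) (B u)" for u
    using form by (simp add: bilinear_form_def)
  note B = form[unfolded bilinear_form_alt[OF vector_space_axioms]]
  \<comment> \<open>\<open>\<Phi> u\<close> stores the values of \<open>B u\<close> on
    \<open>Basis\<close> as coordinates of a vector. The space itself thus replaces its dual, and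
    injectivity of a linear endomorphism yields surjectivity.\<close>
  define \<Phi> where "\<Phi> u = (\<Sum>b\<in>Basis. scale (B u b) b)" for u
  have lin: "Vector_Spaces.linear scale scale \<Phi>"
    unfolding linear_iff \<Phi>_def
    by (simp add: vector_space_axioms B scale_left_distrib sum.distrib scale_sum_right)
  have coords: "f b = g b" if "(\<Sum>b\<in>Basis. scale (f b) b) = (\<Sum>b\<in>Basis. scale (g b) b)" "b \<in> Basis"
    for f g b
  proof -
    have "(\<Sum>b\<in>Basis. scale (f b - g b) b) = 0"
      using that by (simp add: scale_left_diff_distrib sum_subtractf)
    then show ?thesis
      using independent_Basis finite_Basis that(2) independentD[of Basis Basis "\<lambda>b. f b - g b" b] by simp
  qed
  have ext: "f = g" if "Vector_Spaces.linear scale (*) f" "Vector_Spaces.linear scale (*) g"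
    "\<And>b. b \<in> Basis \<Longrightarrow> f b = g b" for f g
    using K.linear_eq_on_span[OF that] span_Basis by auto
  have "inj \<Phi>"
  proof (rule injI)
    fix u v assume "\<Phi> u = \<Phi> v"
    then have "B u = B v"
      unfolding \<Phi>_def using coords linB by (intro ext) auto
    then show "u = v"
      by (intro nondegenerate_left_cancel[OF vector_space_axioms form nd]) simp
  qed
  then have "surj \<Phi>"
    using lin by (rule linear_inj_imp_surj[rotated])
  then obtain u where "\<Phi> u = (\<Sum>b\<in>Basis. scale (\<phi> b) b)"
    by (metis surjD)
  then have "B u = \<phi>"
    unfolding \<Phi>_def using coords linB \<phi> by (intro ext) auto
  then show ?thesis
    by auto
qed

text \<open>Each functional \<open>z \<mapsto> B y (F x z)\<close> has a unique representing vector,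
  which becomes \<open>p x y\<close>. So \<open>p x\<close> is the adjoint of \<open>F x\<close>,
  and uniqueness carries bilinearity over from \<open>F\<close> and \<open>B\<close>.\<close>

lemma (in fin_dim_space) adjoint_product:
  assumes form: "bilinear_form scale B" and nd: "nondegenerate B"
    and F: "bilinear_product scale F"
  shows "\<exists>p. bilinear_product scale p \<and> (\<forall>x y z. B (p x y) z = B y (F x z))"
proof -
  obtain Basis where "finite_dimensional_vector_space scale Basis"
    using finite_dimensional by blast
  then interpret fd: finite_dimensional_vector_space scale Basis .
  note B = form[unfolded bilinear_form_alt[OF vector_space_axioms]]
  note F' = F[unfolded bilinear_product_alt[OF vector_space_axioms]]
  note cancel = nondegenerate_left_cancel[OF vector_space_axioms form nd]
  have "\<exists>u. \<forall>z. B u z = B y (F x z)" for x y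
    by (intro fd.nondegenerate_represents[OF form nd]) (simp add: linear_iff vector_space_axioms vector_space_field B F')
  then have "\<exists>p. \<forall>x y z. B (p x y) z = B y (F x z)"
    by (intro choice allI)
  then obtain p where p: "\<And>x y z. B (p x y) z = B y (F x z)"
    by blast
  have "bilinear_product scale p"
    unfolding bilinear_product_alt[OF vector_space_axioms]
    by (intro conjI allI cancel) (simp_all add: p B F')
  with p show ?thesis
    by blast
qed

section \<open>Operator identities in an L-dendriform algebra\<close>

context L_dendriform_algebra
begin

lemmas rt_bilinear = bilinear_rt[unfolded bilinear_product_alt[OF vector_space_axioms], rule_format]

lemmas lt_bilinear = bilinear_lt[unfolded bilinear_product_alt[OF vector_space_axioms], rule_format]

lemma rt_add: "x \<triangleright> (y + z) = x \<triangleright> y + x \<triangleright> z" "(x + y) \<triangleright> z = x \<triangleright> z + y \<triangleright> z"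
  using rt_bilinear by blast+

lemma lt_add: "x \<triangleleft> (y + z) = x \<triangleleft> y + x \<triangleleft> z" "(x + y) \<triangleleft> z = x \<triangleleft> z + y \<triangleleft> z"
  using lt_bilinear by blast+

lemma rt_diff: "x \<triangleright> (y - z) = x \<triangleright> y - x \<triangleright> z" "(x - y) \<triangleright> z = x \<triangleright> z - y \<triangleright> z"
  by (metis add_diff_cancel diff_add_cancel rt_add)+

lemma lt_diff: "x \<triangleleft> (y - z) = x \<triangleleft> y - x \<triangleleft> z" "(x - y) \<triangleleft> z = x \<triangleleft> z - y \<triangleleft> z"
  by (metis add_diff_cancel diff_add_cancel lt_add)+

lemmas product_simps = bullet_def circ_def bracket_def rt_add lt_add rt_diff lt_diff

lemma scale_product:
  "x \<triangleright> scale c y = scale c (x \<triangleright> y)" "scale c x \<triangleright> y = scale c (x \<triangleright> y)"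
  "x \<triangleleft> scale c y = scale c (x \<triangleleft> y)" "scale c x \<triangleleft> y = scale c (x \<triangleleft> y)"
  using rt_bilinear lt_bilinear by blast+

text \<open>The defect is that of \<open>dendriform1\<close> plus the difference of two defects of
  \<open>dendriform2\<close> with \<open>x\<close> and \<open>y\<close> exchanged. Thus
  \<open>\<bullet>\<close> is a pre-Lie product with commutator \<open>bracket\<close>.\<close>

lemma bullet_left_symmetric:
  "x \<bullet> (y \<bullet> z) - (x \<bullet> y) \<bullet> z = y \<bullet> (x \<bullet> z) - (y \<bullet> x) \<bullet> z"
proof -
  have "(x \<bullet> (y \<bullet> z) - (x \<bullet> y) \<bullet> z) - (y \<bullet> (x \<bullet> z) - (y \<bullet> x) \<bullet> z) =
    ((x \<triangleright> (y \<triangleright> z) - (x \<bullet> y) \<triangleright> z) - (y \<triangleright> (x \<triangleright> z) - (y \<bullet> x) \<triangleright> z)) +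
    ((x \<triangleright> (y \<triangleleft> z) - (x \<triangleright> y) \<triangleleft> z) - (y \<triangleleft> (x \<bullet> z) - (y \<triangleleft> x) \<triangleleft> z)) -
    ((y \<triangleright> (x \<triangleleft> z) - (y \<triangleright> x) \<triangleleft> z) - (x \<triangleleft> (y \<bullet> z) - (x \<triangleleft> y) \<triangleleft> z))"
    by (simp add: product_simps algebra_simps)
  also have "\<dots> = 0"
    using dendriform1[of x y z] dendriform2[of x y z] dendriform2[of y x z] by simp
  finally show ?thesis
    by simp
qed

text \<open>The Jacobi defect is the cyclic sum of three left-symmetry defects of
  \<open>\<bullet>\<close>.\<close>

lemma bracket_jacobi: "bracket x (bracket y w) - bracket y (bracket x w) = bracket (bracket x y) w"
proof -
  have "bracket x (bracket y w) - bracket y (bracket x w) - bracket (bracket x y) w =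
    ((x \<bullet> (y \<bullet> w) - (x \<bullet> y) \<bullet> w) - (y \<bullet> (x \<bullet> w) - (y \<bullet> x) \<bullet> w)) +
    ((y \<bullet> (w \<bullet> x) - (y \<bullet> w) \<bullet> x) - (w \<bullet> (y \<bullet> x) - (w \<bullet> y) \<bullet> x)) +
    ((w \<bullet> (x \<bullet> y) - (w \<bullet> x) \<bullet> y) - (x \<bullet> (w \<bullet> y) - (x \<bullet> w) \<bullet> y))"
    by (simp add: product_simps algebra_simps)
  also have "\<dots> = 0"
    using bullet_left_symmetric[of x y w] bullet_left_symmetric[of y w x]
      bullet_left_symmetric[of w x y] by simp
  finally show ?thesis
    by simp
qed

text \<open>The right side is \<open>x \<odot> (w \<odot> y)\<close>, unfolded to match the pairing
  with \<open>\<succ>\<close>. So left \<open>\<odot>\<close>-multiplication represents the Lie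
  bracket, as left multiplication by \<open>\<triangleright>\<close> and \<open>\<bullet>\<close>
  does in \<open>bracket_rt\<close> and \<open>bracket_bullet\<close>.\<close>

lemma circ_bracket: "bracket x w \<odot> y + w \<odot> (x \<odot> y) = x \<triangleright> (w \<odot> y) - (w \<odot> y) \<triangleleft> x"
proof -
  have "bracket x w \<odot> y + w \<odot> (x \<odot> y) - (x \<triangleright> (w \<odot> y) - (w \<odot> y) \<triangleleft> x) =
    ((x \<triangleright> (y \<triangleleft> w) - (x \<triangleright> y) \<triangleleft> w) - (y \<triangleleft> (x \<bullet> w) - (y \<triangleleft> x) \<triangleleft> w)) -
    ((w \<triangleright> (y \<triangleleft> x) - (w \<triangleright> y) \<triangleleft> x) - (y \<triangleleft> (w \<bullet> x) - (y \<triangleleft> w) \<triangleleft> x)) -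
    ((x \<triangleright> (w \<triangleright> y) - (x \<bullet> w) \<triangleright> y) - (w \<triangleright> (x \<triangleright> y) - (w \<bullet> x) \<triangleright> y))"
    by (simp add: product_simps algebra_simps)
  also have "\<dots> = 0"
    using dendriform1[of x w y] dendriform2[of x y w] dendriform2[of w y x] by simp
  finally show ?thesis
    by simp
qed

lemma bracket_rt: "bracket x w \<triangleright> y + w \<triangleright> (x \<triangleright> y) = x \<triangleright> (w \<triangleright> y)"
  using dendriform1[of x w y] by (simp add: bracket_def rt_diff algebra_simps)

text \<open>The left factors \<open>w \<triangleright> x\<close> and
  \<open>x \<triangleleft> w\<close> in \<open>dendriform2\<close> combine to
  \<open>w \<odot> x\<close>.\<close>

lemma circ_lt: "(w \<odot> x) \<triangleleft> y + x \<triangleleft> (w \<bullet> y) = w \<triangleright> (x \<triangleleft> y)"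
  using dendriform2[of w x y] by (simp add: circ_def lt_diff algebra_simps)

lemma bracket_bullet: "bracket x w \<bullet> y + w \<bullet> (x \<bullet> y) = x \<bullet> (w \<bullet> y)"
proof -
  have "bracket x w \<bullet> y = (x \<bullet> w) \<bullet> y - (w \<bullet> x) \<bullet> y"
    by (simp add: product_simps algebra_simps)
  with bullet_left_symmetric[of x w y] show ?thesis
    by (simp only:) (simp add: algebra_simps)
qed

end

section \<open>Construction of the four products and verification of the axioms\<close>

theorem proposition3p18:
  fixes scale :: "'k::field_char_0 \<Rightarrow> 'a::ab_group_add \<Rightarrow> 'a"
    and rt :: "'a \<Rightarrow> 'a \<Rightarrow> 'a"  (infixl "\<triangleright>" 70)
    and lt :: "'a \<Rightarrow> 'a \<Rightarrow> 'a"  (infixl "\<triangleleft>" 70)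
    and B :: "'a \<Rightarrow> 'a \<Rightarrow> 'k"
  assumes "L_dendriform_algebra scale (\<triangleright>) (\<triangleleft>)"
    and "two_cocycle scale (\<triangleright>) (\<triangleleft>) B"
    and "nondegenerate B"
  shows "\<exists>se ne nw sw :: 'a \<Rightarrow> 'a \<Rightarrow> 'a.
    (\<forall>x y z. B (se x y) z = - B y (dendriform_products.bracket (\<triangleright>) (\<triangleleft>) x z)) \<and>
    (\<forall>x y z. B (nw x y) z = B y (z \<triangleright> x)) \<and>
    (\<forall>x y z. B (ne x y) z = - B y (dendriform_products.circ (\<triangleright>) (\<triangleleft>) z x)) \<and>
    (\<forall>x y z. B (sw x y) z = - B y (dendriform_products.bullet (\<triangleright>) (\<triangleleft>) z x)) \<and>
    L_quadri_algebra scale se ne nw sw \<and>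
    quadri_products.horizontal se ne nw sw = ((\<triangleright>), (\<triangleleft>))"
proof -
  interpret L_dendriform_algebra scale "(\<triangleright>)" "(\<triangleleft>)"
    by fact
  have form: "bilinear_form scale B" and skew: "B x y = - B y x"
    and cocycle: "B (x \<triangleleft> y) z = - B y (z \<odot> x) + B x (z \<bullet> y)" for x y z
    using assms(2) unfolding two_cocycle_def skew_symmetric_def by blast+
  note B' = form[unfolded bilinear_form_alt[OF vector_space_axioms], rule_format]
  have B_add: "B x (y + z) = B x y + B x z" "B (x + y) z = B x z + B y z" for x y z
    using B' by blast+
  have B_diff: "B x (y - z) = B x y - B x z" "B (x - y) z = B x z - B y z" for x y z
    by (metis add_diff_cancel diff_add_cancel B_add)+
  have B_minus: "B x (- y) = - B x y" for x y
    using B_diff(1)[of x 0 y] B_diff(1)[of x 0 0] by simp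
  note cancel = nondegenerate_left_cancel[OF vector_space_axioms form assms(3)]
  note simps = product_simps scale_product scale_right_distrib scale_right_diff_distrib
  \<comment> \<open>These are the maps whose adjoints are the four products; the signs are put into
    the maps so that \<open>adjoint_product\<close> applies directly.\<close>
  have "bilinear_product scale (\<lambda>x z. - bracket x z)" "bilinear_product scale (\<lambda>x z. z \<triangleright> x)"
    "bilinear_product scale (\<lambda>x z. - (z \<odot> x))" "bilinear_product scale (\<lambda>x z. - (z \<bullet> x))"
    by (simp_all add: bilinear_product_alt[OF vector_space_axioms] simps algebra_simps)
  note adjoints = this[THEN adjoint_product[OF form assms(3)]]
  obtain se where bil_se: "bilinear_product scale se"
      and se: "\<And>x y z. B (se x y) z = - B y (bracket x z)"
    using adjoints(1) by (auto simp: B_minus)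
  obtain nw where bil_nw: "bilinear_product scale nw"
      and nw: "\<And>x y z. B (nw x y) z = B y (z \<triangleright> x)"
    using adjoints(2) by auto
  obtain ne where bil_ne: "bilinear_product scale ne"
      and ne: "\<And>x y z. B (ne x y) z = - B y (z \<odot> x)"
    using adjoints(3) by (auto simp: B_minus)
  obtain sw where bil_sw: "bilinear_product scale sw"
      and sw: "\<And>x y z. B (sw x y) z = - B y (z \<bullet> x)"
    using adjoints(4) by (auto simp: B_minus)
  interpret Q: quadri_products se ne nw sw .

  have lt_eq: "ne x y - sw y x = x \<triangleleft> y" for x y
    by (rule cancel) (simp add: B_diff ne sw cocycle)
  have rt_eq: "se x y - nw y x = x \<triangleright> y" for x y
  proof (rule cancel)
    fix z
    show "B (se x y - nw y x) z = B (x \<triangleright> y) z"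
      \<comment> \<open>Subtracting the cocycle identity with \<open>x\<close> and \<open>z\<close>
        exchanged turns the \<open>\<odot>\<close> terms into \<open>bracket x z\<close>; by
        skew-symmetry the remaining \<open>\<triangleleft>\<close> terms cancel.\<close>
      using cocycle[of x y z] cocycle[of z y x] skew[of "x \<triangleright> y" z] skew[of "x \<triangleleft> y" z] skew[of "z \<triangleleft> y" x]
      by (simp add: se nw B_diff B_add product_simps algebra_simps)
  qed
  \<comment> \<open>These differences, with \<open>rt_eq\<close> and \<open>lt_eq\<close>, are the
    combinations of nested left factors that occur in the five axioms.\<close>
  have star_diff: "Q.star x y - Q.star y x = bracket x y" for x y
    unfolding Q.star_def bracket_def bullet_def
    by (simp add: rt_eq[symmetric] lt_eq[symmetric] algebra_simps)
  have vee_wedge: "Q.vee x y - Q.wedge y x = x \<odot> y" for x y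
    unfolding Q.vee_def Q.wedge_def circ_def
    by (simp add: rt_eq[symmetric] lt_eq[symmetric] algebra_simps)
  have succ_prec: "Q.succ x y - Q.prec y x = x \<bullet> y" for x y
    unfolding Q.succ_def Q.prec_def bullet_def
    by (simp add: rt_eq[symmetric] lt_eq[symmetric] algebra_simps)

  \<comment> \<open>The composite products are adjoints too: for \<open>Q.star\<close> the four maps
    add up to \<open>- (x \<triangleright> z)\<close>.\<close>
  have star: "B (Q.star x y) z = - B y (x \<triangleright> z)" for x y z
    by (simp add: Q.star_def B_add B_diff se ne nw sw product_simps)
  have succ: "B (Q.succ x y) z = - B y (x \<triangleright> z - z \<triangleleft> x)" for x y z
    by (simp add: Q.succ_def B_add B_diff se ne product_simps)
  have prec: "B (Q.prec x y) z = - B y (z \<triangleleft> x)" for x y z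
    by (simp add: Q.prec_def B_add B_diff nw sw product_simps)
  have vee: "B (Q.vee x y) z = - B y (x \<bullet> z)" for x y z
    by (simp add: Q.vee_def B_add B_diff se sw product_simps)
  have wedge: "B (Q.wedge x y) z = B y (x \<triangleleft> z)" for x y z
    by (simp add: Q.wedge_def B_add B_diff ne nw product_simps)

  note bilinear = bilinear_product_alt[OF vector_space_axioms]
  have left_diff: "p (x - y) z = p x z - p y z" if "bilinear_product scale p" for p x y z
  proof -
    have "p (x - y) z + p y z = p x z"
      using that unfolding bilinear by (metis diff_add_cancel)
    then show ?thesis
      by (simp add: algebra_simps)
  qed
  note diff_se = left_diff[OF bil_se] and diff_ne = left_diff[OF bil_ne]
    and diff_nw = left_diff[OF bil_nw] and diff_sw = left_diff[OF bil_sw]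

  \<comment> \<open>Brings together \<open>b\<close> and \<open>d\<close>, the two terms with a
    nested left factor; linearity in that factor then merges them.\<close>
  have regroup: "a - b = c - d" if "a - (b - d) = c" for a b c d :: 'a
    using that by (simp add: algebra_simps)

  have "L_quadri_algebra scale se ne nw sw"
  proof unfold_locales
    fix x y z
    show "se x (se y z) - se (Q.star x y) z = se y (se x z) - se (Q.star y x) z"
    proof (rule regroup, unfold diff_se[symmetric] star_diff, rule cancel)
      fix w
      show "B (se x (se y z) - se (bracket x y) z) w = B (se y (se x z)) w"
        \<comment> \<open>Adjoints reverse the order: \<open>B (se x (se y z)) w\<close> equals
          \<open>B z (bracket y (bracket x w))\<close>, the two signs cancelling.\<close>
        using arg_cong[OF bracket_jacobi[of x y w], of "B z"] by (simp add: B_diff se algebra_simps)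
    qed
    show "se x (ne y z) - ne (Q.vee x y) z = ne y (Q.succ x z) - ne (Q.wedge y x) z"
    proof (rule regroup, unfold diff_ne[symmetric] vee_wedge, rule cancel)
      fix w
      show "B (se x (ne y z) - ne (x \<odot> y) z) w = B (ne y (Q.succ x z)) w"
        using arg_cong[OF circ_bracket[of x w y], of "B z"]
        by (simp add: B_diff B_add se ne succ algebra_simps)
    qed
    show "se x (nw y z) - nw (se x y) z = nw y (Q.star x z) - nw (nw y x) z"
    proof (rule regroup, unfold diff_nw[symmetric] rt_eq, rule cancel)
      fix w
      show "B (se x (nw y z) - nw (x \<triangleright> y) z) w = B (nw y (Q.star x z)) w"
        using arg_cong[OF bracket_rt[of x w y], of "B z"]
        by (simp add: B_diff B_add se nw star algebra_simps)
    qed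
    show "ne x (Q.prec y z) - nw (ne x y) z = sw y (Q.wedge x z) - nw (sw y x) z"
    proof (rule regroup, unfold diff_nw[symmetric] lt_eq, rule cancel)
      fix w
      show "B (ne x (Q.prec y z) - nw (x \<triangleleft> y) z) w = B (sw y (Q.wedge x z)) w"
        \<comment> \<open>Here \<open>w\<close> comes first, because the maps adjoint to
          \<open>ne\<close>, \<open>nw\<close> and \<open>sw\<close> multiply by their argument from
          the left.\<close>
        using arg_cong[OF circ_lt[of w x y], of "B z"]
        by (simp add: B_diff B_add ne nw sw prec wedge algebra_simps)
    qed
    show "se x (sw y z) - sw (Q.succ x y) z = sw y (Q.vee x z) - sw (Q.prec y x) z"
    proof (rule regroup, unfold diff_sw[symmetric] succ_prec, rule cancel)
      fix w
      show "B (se x (sw y z) - sw (x \<bullet> y) z) w = B (sw y (Q.vee x z)) w"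
        using arg_cong[OF bracket_bullet[of x w y], of "B z"]
        by (simp add: B_diff B_add se sw vee algebra_simps)
    qed
  qed (fact bil_se bil_ne bil_nw bil_sw)+
  moreover have "Q.horizontal = ((\<triangleright>), (\<triangleleft>))"
    by (simp add: Q.horizontal_def rt_eq lt_eq)
  ultimately show ?thesis
    using se nw ne sw by blast
qed

end
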